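(* Let $X$ be a Banach space and consider the nonautonomous equation $$u_t=f(u)+g(t),\quad t>\tau;\qquad u(\tau)=u_\tau\in X,$$ where $f:D(f)\subset X\to X$ and $g:\mathbb{R}\to X$ are continuous, and whose solutions are given by a continuous cocycle $\varphi:[0,\infty)\times\mathscr{H}(g)\times X\to X$ with associated skew product flow $\Phi$ on $\mathscr{H}(g)\times X$ (see context). Suppose that $g$ is a recurrent function. If $\Phi$ has a nonempty compact invariant set $K\subset\mathscr{H}(g)\times X$, then the equation has a recurrent solution $\gamma:\mathbb{R}\to X$ such that $$\{(\theta_t g,\gamma(t)):t\in\mathbb{R}\}\subset K.$$
   Context: Recurrent functions: for a complete metric space $(X,d)$ let $S=C(\mathbb{R},X)$ with the compact-open topology, metrized by the complete metric $$\rho(g_1,g_2)=\sum_{n=1}^\infty \frac1{2^n}\frac{\max_{t\in[-n,n]}d(g_1(t),g_2(t))}{1+\max_{t\in[-n,n]}d(g_1(t),g_2(t))},$$ and let $\theta_\tau g=g(\cdot+\tau)$, $\tau\in\mathbb{R}$, which defines a flow on $S$. The hull of $g$ is $\mathscr{H}(g)=\overline{\{\theta_t g:t\in\mathbb{R}\}}$ (closure in $(S,\rho)$). A function $g\in S$ is recurrent if (1) for every $\varepsilon>0$ there is $l>0$ such that for all $a\in\mathbb{R}$ the $\rho$-distance from $g$ to $\{\theta_t g:t\in[a,a+l]\}$ is less than $\varepsilon$, and (2) $\mathscr{H}(g)$ is compact. Standing assumptions on the equation: for every $\tau\in\mathbb{R}$ and $u_\tau\in X$ it has a global solution $u(t,\tau;u_\tau)$,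 $t\ge\tau$. The solution operator is given by a continuous cocycle, i.e. a continuous map $\varphi:[0,\infty)\times\mathscr{H}(g)\times X\to X$ with $$\varphi(0,\tilde g,x)=x,\qquad \varphi(t+\tau,\tilde g,x)=\varphi(t,\theta_\tau\tilde g,\varphi(\tau,\tilde g,x))$$ for all $t,\tau\ge0$, $\tilde g\in\mathscr{H}(g)$, $x\in X$, where $\varphi(t,\tilde g,x)$ is the value at time $t$ of the solution of $u_t=f(u)+\tilde g(t)$, $u(0)=x$. In particular $u(t,\tau;x)=\varphi(t-\tau,\theta_\tau g,x)$ for $t\ge\tau$. The skew product flow is the semiflow $\Phi$ on $\mathscr{H}(g)\times X$, $\Phi(t,\tilde g,x)=(\theta_t\tilde g,\varphi(t,\tilde g,x))$, $t\ge 0$, where $\mathscr{H}(g)\times X$ carries the metric $\rho(g_1,g_2)+d(x_1,x_2)$, with $d$ the norm metric. A set $K$ is invariant if $\Phi(t)K=K$ for all $t\ge0$. A solution of the equation on $\mathbb{R}$ is a function $\gamma:\mathbb{R}\to X$ with $\gamma(t)=u(t,s;\gamma(s))=\varphi(t-s,\theta_s g,\gamma(s))$ for all $t\ge s$. A recurrent solution of the equation is a solution defined on $\mathbb{R}$ that is a recurrent function in $C(\mathbb{R},X)$. *)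

theory Defs
  imports "HOL-Analysis.Analysis"
begin

section \<open>The metric space of continuous functions on the real line\<close>

typedef (overloaded) 'a cfun = "{g :: real \<Rightarrow> 'a::topological_space. continuous_on UNIV g}"
  morphisms apply_cfun Cfun
  using continuous_on_const by blast

setup_lifting type_definition_cfun

lemma continuous_on_apply_cfun [simp, intro]: "continuous_on T (apply_cfun g)"
proof -
  have "continuous_on UNIV (apply_cfun g)"
    using apply_cfun[of g] by simp
  then show ?thesis
    by (rule continuous_on_subset) (rule subset_UNIV)
qed

lift_definition shift :: "real \<Rightarrow> 'a::topological_space cfun \<Rightarrow> 'a cfun"
  is "\<lambda>\<tau> g t. g (t + \<tau>)"
  by (erule continuous_on_compose2) (auto intro!: continuous_intros)

text \<open>The supremum below is attained, the functions being continuous and the interval compact.\<close>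

definition maxdist :: "nat \<Rightarrow> 'a::metric_space cfun \<Rightarrow> 'a cfun \<Rightarrow> real"
  where "maxdist n g1 g2 =
    (SUP t\<in>{- real n..real n}. dist (apply_cfun g1 t) (apply_cfun g2 t))"

lemma continuous_on_dist_cfun:
  "continuous_on T (\<lambda>t. dist (apply_cfun g1 t) (apply_cfun g2 t))"
  by (rule continuous_on_dist) (rule continuous_on_apply_cfun)+

lemma bdd_above_dist_cfun:
  "bdd_above ((\<lambda>t. dist (apply_cfun g1 t) (apply_cfun g2 t)) ` {- real n..real n})"
  by (rule bounded_imp_bdd_above, rule compact_imp_bounded,
      rule compact_continuous_image[OF continuous_on_dist_cfun], rule compact_Icc)

lemma dist_le_maxdist:
  assumes "t \<in> {- real n..real n}"
  shows "dist (apply_cfun g1 t) (apply_cfun g2 t) \<le> maxdist n g1 g2"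
  unfolding maxdist_def by (rule cSUP_upper[OF assms bdd_above_dist_cfun])

lemma maxdist_attained:
  "\<exists>t\<in>{- real n..real n}. maxdist n g1 g2 = dist (apply_cfun g1 t) (apply_cfun g2 t)"
proof -
  have ne: "{- real n..real n} \<noteq> {}"
    by simp
  obtain t where t: "t \<in> {- real n..real n}"
    and le: "\<forall>s\<in>{- real n..real n}.
      dist (apply_cfun g1 s) (apply_cfun g2 s) \<le> dist (apply_cfun g1 t) (apply_cfun g2 t)"
    using continuous_attains_sup[OF compact_Icc ne continuous_on_dist_cfun] by blast
  have "maxdist n g1 g2 \<le> dist (apply_cfun g1 t) (apply_cfun g2 t)"
    unfolding maxdist_def by (rule cSUP_least[OF ne]) (rule bspec[OF le])
  then have "maxdist n g1 g2 = dist (apply_cfun g1 t) (apply_cfun g2 t)"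
    using dist_le_maxdist[OF t] by (rule order_antisym)
  with t show ?thesis ..
qed

lemma maxdist_nonneg: "0 \<le> maxdist n g1 g2"
  using maxdist_attained[of n g1 g2] by auto

lemma maxdist_triangle2: "maxdist n g1 g2 \<le> maxdist n g1 g3 + maxdist n g2 g3"
proof -
  obtain t where t: "t \<in> {- real n..real n}"
    and eq: "maxdist n g1 g2 = dist (apply_cfun g1 t) (apply_cfun g2 t)"
    using maxdist_attained by blast
  show ?thesis
    unfolding eq using dist_triangle2[of "apply_cfun g1 t" "apply_cfun g2 t" "apply_cfun g3 t"]
      dist_le_maxdist[OF t, of g1 g3] dist_le_maxdist[OF t, of g2 g3] by linarith
qed

instantiation cfun :: (metric_space) metric_space
begin

text \<open>The series starts at index 1, hence the successors.\<close>

definition dist_cfun :: "'a cfun \<Rightarrow> 'a cfun \<Rightarrow> real"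
  where "dist_cfun g1 g2 =
    (\<Sum>n. 1 / 2 ^ Suc n * (maxdist (Suc n) g1 g2 / (1 + maxdist (Suc n) g1 g2)))"

definition uniformity_cfun :: "('a cfun \<times> 'a cfun) filter"
  where "uniformity_cfun = (INF e\<in>{0 <..}. principal {(x, y). dist x y < e})"

definition open_cfun :: "'a cfun set \<Rightarrow> bool"
  where "open_cfun S = (\<forall>x\<in>S. \<forall>\<^sub>F (x', y) in uniformity. x' = x \<longrightarrow> y \<in> S)"

lemma summable_dist_cfun:
  fixes g1 g2 :: "'a cfun"
  shows "summable (\<lambda>n. 1 / 2 ^ Suc n * (maxdist (Suc n) g1 g2 / (1 + maxdist (Suc n) g1 g2)))"
proof (rule summable_comparison_test')
  show "summable (\<lambda>n. (1 / 2 :: real) ^ n)"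
    by (rule summable_geometric) auto
  show "norm (1 / 2 ^ Suc n * (maxdist (Suc n) g1 g2 / (1 + maxdist (Suc n) g1 g2)))
      \<le> (1 / 2 :: real) ^ n" for n
  proof -
    have "0 \<le> maxdist (Suc n) g1 g2"
      by (rule maxdist_nonneg)
    then have "0 \<le> maxdist (Suc n) g1 g2 / (1 + maxdist (Suc n) g1 g2)"
      "maxdist (Suc n) g1 g2 / (1 + maxdist (Suc n) g1 g2) \<le> 1"
      by (auto simp: divide_simps)
    then have "1 / 2 ^ Suc n * (maxdist (Suc n) g1 g2 / (1 + maxdist (Suc n) g1 g2))
        \<le> 1 / 2 ^ Suc n * 1"
      "0 \<le> 1 / 2 ^ Suc n * (maxdist (Suc n) g1 g2 / (1 + maxdist (Suc n) g1 g2))"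
      by (intro mult_left_mono mult_nonneg_nonneg; simp)+
    moreover have "1 / 2 ^ Suc n * 1 \<le> (1 / 2 :: real) ^ n"
      by (simp add: power_divide divide_simps)
    ultimately show ?thesis
      by (metis abs_of_nonneg order_trans real_norm_def)
  qed
qed

instance
proof
  fix f g h :: "'a cfun"
  show "dist f g = 0 \<longleftrightarrow> f = g"
  proof
    assume "dist f g = 0"
    then have *: "\<forall>n. 1 / 2 ^ Suc n * (maxdist (Suc n) f g / (1 + maxdist (Suc n) f g)) = 0"
      unfolding dist_cfun_def
      by (subst (asm) suminf_eq_zero_iff[OF summable_dist_cfun])
         (simp_all add: maxdist_nonneg)
    have zero: "maxdist (Suc n) f g = 0" for n
      using *[rule_format, of n] maxdist_nonneg[of "Suc n" f g] by simp
    have "apply_cfun f t = apply_cfun g t" for t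
    proof -
      obtain n where "\<bar>t\<bar> \<le> real n"
        using real_arch_simple by blast
      then have "t \<in> {- real (Suc n)..real (Suc n)}"
        by auto
      from dist_le_maxdist[OF this, of f g] show ?thesis
        using zero[of n] by simp
    qed
    then show "f = g"
      by (simp add: apply_cfun_inject[symmetric] fun_eq_iff)
  next
    assume "f = g"
    moreover have "maxdist n g g = 0" for n
      using maxdist_attained[of n g g] by auto
    ultimately show "dist f g = 0"
      by (simp add: dist_cfun_def)
  qed
  have mono: "a / (1 + a) \<le> b / (1 + b) + c / (1 + c)"
    if "0 \<le> a" "0 \<le> b" "0 \<le> c" "a \<le> b + c" for a b c :: real
  proof -
    have "a / (1 + a) = 1 - 1 / (1 + a)"
      using that by (simp add: field_simps)
    also have "\<dots> \<le> 1 - 1 / (1 + (b + c))"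
      using that by (intro diff_mono order_refl divide_left_mono mult_pos_pos) auto
    also have "\<dots> = (b + c) / (1 + (b + c))"
      using that by (simp add: field_simps)
    also have "\<dots> = b / (1 + (b + c)) + c / (1 + (b + c))"
      by (rule add_divide_distrib)
    also have "\<dots> \<le> b / (1 + b) + c / (1 + c)"
      using that by (intro add_mono divide_left_mono mult_pos_pos) auto
    finally show ?thesis .
  qed
  let ?F = "\<lambda>f g n. 1 / 2 ^ Suc n * (maxdist (Suc n) f g / (1 + maxdist (Suc n) f g))"
  have "?F f g n \<le> ?F f h n + ?F g h n" for n
  proof -
    have "?F f g n \<le> 1 / 2 ^ Suc n * (maxdist (Suc n) f h / (1 + maxdist (Suc n) f h)
        + maxdist (Suc n) g h / (1 + maxdist (Suc n) g h))"
      by (intro mult_left_mono mono maxdist_nonneg maxdist_triangle2) simp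
    then show ?thesis
      by (simp only: distrib_left)
  qed
  then have "suminf (?F f g) \<le> (\<Sum>n. ?F f h n + ?F g h n)"
    by (intro suminf_le summable_add summable_dist_cfun)
  also have "\<dots> = suminf (?F f h) + suminf (?F g h)"
    by (rule suminf_add[symmetric]) (rule summable_dist_cfun)+
  finally show "dist f g \<le> dist f h + dist g h"
    unfolding dist_cfun_def .
qed (rule open_cfun_def uniformity_cfun_def)+

end

section \<open>Recurrent functions\<close>

definition flow_hull :: "'a::metric_space cfun \<Rightarrow> 'a cfun set"
  where "flow_hull g = closure (range (\<lambda>t. shift t g))"

definition recurrent :: "'a::metric_space cfun \<Rightarrow> bool"
  where "recurrent g \<longleftrightarrow>
    (\<forall>\<epsilon>>0. \<exists>l>0. \<forall>a. infdist g ((\<lambda>t. shift t g) ` {a..a + l}) < \<epsilon>) \<and> compact (flow_hull g)"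

section \<open>The equation and its skew product flow\<close>

text \<open>\<open>u\<close> solves \<open>u' = f(u) + h(t)\<close> for \<open>t > \<tau>\<close> with \<open>u(\<tau>) = x\<close>. Here \<open>D\<close> is the
  domain of \<open>f\<close>; the initial value need not belong to it. The derivative is taken in the norm
  of the space: when \<open>f\<close> is continuous on \<open>D\<close>, integral solutions with values in \<open>D\<close> after the
  initial time satisfy the equation in this pointwise sense. Values of \<open>u\<close> before \<open>\<tau>\<close> are
  irrelevant.\<close>

definition solves :: "'a::real_normed_vector set \<Rightarrow> ('a \<Rightarrow> 'a) \<Rightarrow> 'a cfun \<Rightarrow> real \<Rightarrow> 'a \<Rightarrow>
    (real \<Rightarrow> 'a) \<Rightarrow> bool"
  where "solves D f h \<tau> x u \<longleftrightarrow>
    u \<tau> = x \<and> continuous_on {\<tau>..} u \<and>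
    (\<forall>t>\<tau>. u t \<in> D \<and> (u has_vector_derivative f (u t) + apply_cfun h t) (at t))"

text \<open>Cocycles are total functions of the time variable; only nonnegative times and
  forcing terms in the hull of \<open>g\<close> are constrained.\<close>

definition continuous_cocycle ::
    "'a::metric_space cfun \<Rightarrow> (real \<Rightarrow> 'a cfun \<Rightarrow> 'a \<Rightarrow> 'a) \<Rightarrow> bool"
  where "continuous_cocycle g \<phi> \<longleftrightarrow>
    continuous_on ({0..} \<times> flow_hull g \<times> UNIV) (\<lambda>(t, h, x). \<phi> t h x) \<and>
    (\<forall>h\<in>flow_hull g. \<forall>x. \<phi> 0 h x = x) \<and>
    (\<forall>t\<ge>0. \<forall>\<tau>\<ge>0. \<forall>h\<in>flow_hull g. \<forall>x. \<phi> (t + \<tau>) h x = \<phi> t (shift \<tau> h) (\<phi> \<tau> h x))"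

definition solution_cocycle :: "'a::real_normed_vector set \<Rightarrow> ('a \<Rightarrow> 'a) \<Rightarrow> 'a cfun \<Rightarrow>
    (real \<Rightarrow> 'a cfun \<Rightarrow> 'a \<Rightarrow> 'a) \<Rightarrow> bool"
  where "solution_cocycle D f g \<phi> \<longleftrightarrow>
    continuous_cocycle g \<phi> \<and> (\<forall>h\<in>flow_hull g. \<forall>x. solves D f h 0 x (\<lambda>t. \<phi> t h x))"

definition solution_operator ::
    "'a::metric_space cfun \<Rightarrow> (real \<Rightarrow> 'a cfun \<Rightarrow> 'a \<Rightarrow> 'a) \<Rightarrow> real \<Rightarrow> real \<Rightarrow> 'a \<Rightarrow> 'a"
  where "solution_operator g \<phi> t \<tau> x = \<phi> (t - \<tau>) (shift \<tau> g) x"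

text \<open>In particular the equation is globally solvable from every initial time.\<close>

lemma solves_solution_operator:
  assumes "solution_cocycle D f g \<phi>"
  shows "solves D f g \<tau> x (\<lambda>t. solution_operator g \<phi> t \<tau> x)"
proof -
  define u where "u = (\<lambda>t. \<phi> t (shift \<tau> g) x)"
  have "shift \<tau> g \<in> flow_hull g"
    unfolding flow_hull_def by (rule subsetD[OF closure_subset]) simp
  with assms have "solves D f (shift \<tau> g) 0 x u"
    by (simp add: solution_cocycle_def u_def)
  then have u0: "u 0 = x" and cont: "continuous_on {0..} u"
    and D: "\<And>t. t > 0 \<Longrightarrow> u t \<in> D"
    and deriv: "\<And>t. t > 0 \<Longrightarrow>
      (u has_vector_derivative f (u t) + apply_cfun (shift \<tau> g) t) (at t)"
    unfolding solves_def by blast+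
  have "continuous_on {\<tau>..} (\<lambda>t. u (t - \<tau>))"
    by (rule continuous_on_compose2[OF cont]) (auto intro!: continuous_intros)
  moreover have "((\<lambda>t. u (t - \<tau>)) has_vector_derivative
      f (u (t - \<tau>)) + apply_cfun g t) (at t)" if "t > \<tau>" for t
  proof -
    have "(u has_vector_derivative f (u (t - \<tau>)) + apply_cfun g t) (at (t - \<tau>))"
      using deriv[of "t - \<tau>"] that by (simp add: shift.rep_eq)
    moreover have "((\<lambda>t. t - \<tau>) has_vector_derivative 1) (at t)"
      by (auto intro!: derivative_eq_intros)
    ultimately have "(u \<circ> (\<lambda>t. t - \<tau>) has_vector_derivative
        1 *\<^sub>R (f (u (t - \<tau>)) + apply_cfun g t)) (at t)"
      by (intro vector_diff_chain_at)
    then show ?thesis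
      unfolding o_def scaleR_one .
  qed
  moreover have "u (t - \<tau>) \<in> D" if "t > \<tau>" for t
    using D[of "t - \<tau>"] that by simp
  moreover have "u (\<tau> - \<tau>) = x"
    using u0 by simp
  ultimately have "solves D f g \<tau> x (\<lambda>t. u (t - \<tau>))"
    unfolding solves_def by blast
  then show ?thesis
    by (simp add: solution_operator_def u_def)
qed

definition entire_solution ::
    "'a::metric_space cfun \<Rightarrow> (real \<Rightarrow> 'a cfun \<Rightarrow> 'a \<Rightarrow> 'a) \<Rightarrow> (real \<Rightarrow> 'a) \<Rightarrow> bool"
  where "entire_solution g \<phi> \<gamma> \<longleftrightarrow> (\<forall>s t. s \<le> t \<longrightarrow> \<gamma> t = solution_operator g \<phi> t s (\<gamma> s))"

definition skew_product ::
    "(real \<Rightarrow> 'a cfun \<Rightarrow> 'a \<Rightarrow> 'a) \<Rightarrow> real \<Rightarrow> 'a cfun \<times> 'a \<Rightarrow> 'a::metric_space cfun \<times> 'a"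
  where "skew_product \<phi> t = (\<lambda>(h, x). (shift t h, \<phi> t h x))"

text \<open>Subsets of the phase space \<open>flow_hull g \<times> X\<close> live in the type \<open>'a cfun \<times> 'a\<close>. The library
  metric on this product type is the Euclidean combination of the two metrics; it induces the
  same topology as their sum, hence the same compact sets and continuous maps.\<close>

definition invariant_set :: "(real \<Rightarrow> 'a cfun \<Rightarrow> 'a \<Rightarrow> 'a) \<Rightarrow> ('a::metric_space cfun \<times> 'a) set \<Rightarrow> bool"
  where "invariant_set \<phi> K \<longleftrightarrow> (\<forall>t\<ge>0. skew_product \<phi> t ` K = K)"

end

theory Submission
  imports Defs
begin

text \<open>Consider the pairs \<open>(h, \<gamma>)\<close> for which \<open>t \<mapsto> (\<theta>\<^sub>t h, \<gamma>(t))\<close> is an entire trajectory of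
  \<open>\<Phi>\<close> inside \<open>K\<close>. Such a pair is determined by its states at the times \<open>-k\<close>, \<open>k \<in> \<nat>\<close>, and on
  \<open>[-k, k]\<close> it depends on the state at \<open>-k\<close> uniformly, because \<open>\<Phi>\<close> is uniformly continuous on
  \<open>[0, 2k] \<times> K\<close>; hence these pairs form a compact shift invariant set, which is nonempty because
  \<open>\<Phi>(1)\<close> maps \<open>K\<close> onto \<open>K\<close>. By Zorn's lemma it contains a minimal set \<open>M\<close>. Since \<open>g\<close> is
  recurrent, its hull is minimal, so \<open>M\<close> projects onto the hull and contains some \<open>(g, \<gamma>)\<close>. By
  Birkhoff's argument every point of a compact minimal set is recurrent, hence so is \<open>\<gamma>\<close>.\<close>

section \<open>The metric on continuous functions\<close>

lemma maxdist_mono: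
  assumes "m \<le> n"
  shows "maxdist m g h \<le> maxdist n g h"
proof -
  obtain t where t: "t \<in> {- real m..real m}"
    and eq: "maxdist m g h = dist (apply_cfun g t) (apply_cfun h t)"
    using maxdist_attained by blast
  from t assms have "t \<in> {- real n..real n}"
    by auto
  then show ?thesis
    unfolding eq by (rule dist_le_maxdist)
qed

text \<open>A single term of the series controls the maximum, because x / (1 + x) is strictly
  increasing for x \<ge> 0.\<close>

lemma maxdist_less_of_dist:
  assumes "0 < \<epsilon>"
  shows "\<exists>\<delta>>0. \<forall>g h :: 'a::metric_space cfun. dist g h < \<delta> \<longrightarrow> maxdist n g h < \<epsilon>"
proof (intro exI conjI allI impI)
  \<comment> \<open>The term with weight 1 / 2 ^ \<open>Suc n\<close>, evaluated at the maximum
    \<epsilon>. Passing to \<open>Suc n\<close> also covers n = 0, which has no term of its own in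
    the series.\<close>
  define \<delta> where "\<delta> = 1 / 2 ^ Suc n * (\<epsilon> / (1 + \<epsilon>))"
  show "0 < \<delta>"
    using assms by (simp add: \<delta>_def)
  fix g h :: "'a cfun"
  assume d: "dist g h < \<delta>"
  define M where "M = maxdist (Suc n) g h"
  have "0 \<le> M"
    unfolding M_def by (rule maxdist_nonneg)
  have "1 / 2 ^ Suc n * (M / (1 + M)) \<le> dist g h"
    unfolding dist_cfun_def M_def
    using sum_le_suminf[OF summable_dist_cfun[of g h], of "{n}"]
    by (simp add: maxdist_nonneg)
  with d have "1 / 2 ^ Suc n * (M / (1 + M)) < 1 / 2 ^ Suc n * (\<epsilon> / (1 + \<epsilon>))"
    unfolding \<delta>_def by linarith
  then have "M / (1 + M) < \<epsilon> / (1 + \<epsilon>)"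
    by (rule mult_left_less_imp_less) simp
  with \<open>0 \<le> M\<close> assms have "M < \<epsilon>"
    by (simp add: divide_simps algebra_simps split: if_splits)
  then show "maxdist n g h < \<epsilon>"
    using maxdist_mono[of n "Suc n" g h] by (simp add: M_def)
qed

text \<open>Split the series after n terms. In the head each fraction is at most
  \<open>maxdist n g h\<close> and the weights add up to at most 1; in the tail each fraction is at
  most 1 and the weights add up to (1 / 2) ^ n.\<close>

lemma dist_cfun_le_maxdist: "dist g h \<le> maxdist n g h + (1 / 2) ^ n"
proof -
  define F where
    "F = (\<lambda>k. 1 / 2 ^ Suc k * (maxdist (Suc k) g h / (1 + maxdist (Suc k) g h)))"
  have sF: "summable F"
    unfolding F_def by (rule summable_dist_cfun)
  have half: "(\<lambda>k. (1 / 2 :: real) ^ Suc k) sums 1"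
    by (rule power_half_series)
  have F_le: "F k \<le> (1 / 2) ^ Suc k * c" if "maxdist (Suc k) g h / (1 + maxdist (Suc k) g h) \<le> c"
    for k c
    unfolding F_def using mult_left_mono[OF that, of "(1 / 2) ^ Suc k"]
    by (simp add: power_divide)
  have frac: "maxdist k g h / (1 + maxdist k g h) \<le> maxdist k g h"
    "maxdist k g h / (1 + maxdist k g h) \<le> 1" for k
    using maxdist_nonneg[of k g h] by (auto simp: divide_simps algebra_simps)
  have "sum F {..<n} \<le> (\<Sum>k<n. (1 / 2) ^ Suc k * maxdist n g h)"
  proof (rule sum_mono)
    fix k assume "k \<in> {..<n}"
    then have "maxdist (Suc k) g h \<le> maxdist n g h"
      by (intro maxdist_mono) simp
    with frac(1)[of "Suc k"] show "F k \<le> (1 / 2) ^ Suc k * maxdist n g h"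
      by (intro F_le) linarith
  qed
  also have "\<dots> = (\<Sum>k<n. (1 / 2) ^ Suc k) * maxdist n g h"
    by (rule sum_distrib_right[symmetric])
  also have "\<dots> \<le> 1 * maxdist n g h"
    using sum_le_suminf[OF sums_summable[OF half], of "{..<n}"] sums_unique[OF half]
    by (intro mult_right_mono maxdist_nonneg) simp
  finally have 1: "sum F {..<n} \<le> maxdist n g h"
    by simp
  have "(\<lambda>k. (1 / 2) ^ n * (1 / 2 :: real) ^ Suc k) sums ((1 / 2) ^ n * 1)"
    by (rule sums_mult[OF half])
  then have tail: "(\<lambda>k. (1 / 2 :: real) ^ Suc (k + n)) sums ((1 / 2) ^ n)"
    by (simp add: power_add mult_ac)
  have "(\<Sum>k. F (k + n)) \<le> (\<Sum>k. (1 / 2) ^ Suc (k + n))"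
    using F_le[OF frac(2)]
    by (intro suminf_le summable_ignore_initial_segment sF sums_summable[OF tail]) simp
  also have "\<dots> = (1 / 2) ^ n"
    by (rule sums_unique[OF tail, symmetric])
  finally have 2: "(\<Sum>k. F (k + n)) \<le> (1 / 2) ^ n" .
  have "dist g h = (\<Sum>k. F (k + n)) + sum F {..<n}"
    unfolding dist_cfun_def F_def[symmetric] by (rule suminf_split_initial_segment[OF sF])
  with 1 2 show ?thesis
    by linarith
qed

lemma dist_cfun_less_of_maxdist:
  assumes "0 < \<epsilon>"
  shows "\<exists>n. \<forall>g h :: 'a::metric_space cfun. maxdist n g h < \<epsilon> / 2 \<longrightarrow> dist g h < \<epsilon>"
proof -
  obtain n where "(1 / 2 :: real) ^ n < \<epsilon> / 2"
    using real_arch_pow_inv[of "\<epsilon> / 2" "1 / 2"] assms by auto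
  then show ?thesis
    by (intro exI[of _ n] allI impI) (smt (verit) dist_cfun_le_maxdist field_sum_of_halves)
qed

lemma tendsto_cfunI:
  fixes g :: "'i \<Rightarrow> 'a::metric_space cfun"
  assumes "\<And>n. uniform_limit {- real n..real n} (\<lambda>i. apply_cfun (g i)) (apply_cfun h) F"
  shows "(g \<longlongrightarrow> h) F"
proof (rule tendstoI)
  fix \<epsilon> :: real
  assume "0 < \<epsilon>"
  then obtain n where n: "\<And>g h :: 'a cfun. maxdist n g h < \<epsilon> / 2 \<Longrightarrow> dist g h < \<epsilon>"
    using dist_cfun_less_of_maxdist by blast
  have "\<forall>\<^sub>F i in F. \<forall>t\<in>{- real n..real n}. dist (apply_cfun (g i) t) (apply_cfun h t) < \<epsilon> / 2"
    using uniform_limitD[OF assms, of "\<epsilon> / 2" n] \<open>0 < \<epsilon>\<close> by simp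
  then show "\<forall>\<^sub>F i in F. dist (g i) h < \<epsilon>"
  proof eventually_elim
    case (elim i)
    then show ?case
      using maxdist_attained[of n "g i" h] n[of "g i" h] by auto
  qed
qed

section \<open>Shifts\<close>

lemma apply_shift [simp]: "apply_cfun (shift s g) t = apply_cfun g (t + s)"
  by (simp add: shift.rep_eq)

lemma shift_shift: "shift s (shift t g) = shift (s + t) g"
  by (simp add: apply_cfun_inject[symmetric] fun_eq_iff ac_simps)

lemma shift_zero [simp]: "shift 0 g = g"
  by (simp add: apply_cfun_inject[symmetric] fun_eq_iff)

text \<open>A window moved by at most l stays inside a larger window that depends only on l, so one
  \<delta> serves all these shifts. This matters where the shift is chosen after \<delta>.\<close>

lemma shift_equicontinuous:
  assumes "0 < \<epsilon>"
  shows "\<exists>\<delta>>0. \<forall>g h :: 'a::metric_space cfun. dist g h < \<delta> \<longrightarrow>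
    (\<forall>s. \<bar>s\<bar> \<le> l \<longrightarrow> dist (shift s g) (shift s h) < \<epsilon>)"
proof -
  obtain n where n: "\<And>g h :: 'a cfun. maxdist n g h < \<epsilon> / 2 \<Longrightarrow> dist g h < \<epsilon>"
    using dist_cfun_less_of_maxdist[OF assms] by blast
  obtain m where m: "l \<le> real m"
    using real_arch_simple by blast
  obtain \<delta> where "\<delta> > 0"
    and \<delta>: "\<And>g h :: 'a cfun. dist g h < \<delta> \<Longrightarrow> maxdist (n + m) g h < \<epsilon> / 2"
    using maxdist_less_of_dist[of "\<epsilon> / 2"] assms by (metis half_gt_zero)
  have "dist (shift s g) (shift s h) < \<epsilon>" if "dist g h < \<delta>" "\<bar>s\<bar> \<le> l"
    for g h :: "'a cfun" and s
  proof (rule n)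
    obtain t where t: "t \<in> {- real n..real n}"
      and eq: "maxdist n (shift s g) (shift s h) = dist (apply_cfun g (t + s)) (apply_cfun h (t + s))"
      using maxdist_attained[of n "shift s g" "shift s h"] by auto
    have "t + s \<in> {- real (n + m)..real (n + m)}"
      using t m that(2) by auto
    from dist_le_maxdist[OF this, of g h] show "maxdist n (shift s g) (shift s h) < \<epsilon> / 2"
      unfolding eq using \<delta>[OF that(1)] by linarith
  qed
  with \<open>\<delta> > 0\<close> show ?thesis
    by blast
qed

lemma continuous_on_shift: "continuous_on A (shift s :: 'a::metric_space cfun \<Rightarrow> 'a cfun)"
  unfolding continuous_on_iff
proof (intro ballI allI impI)
  fix g :: "'a cfun" and \<epsilon> :: real
  assume "0 < \<epsilon>"
  from shift_equicontinuous[OF this, of "\<bar>s\<bar>"]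
  show "\<exists>\<delta>>0. \<forall>h\<in>A. dist h g < \<delta> \<longrightarrow> dist (shift s h) (shift s g) < \<epsilon>"
    by blast
qed

text \<open>This is the minimality of the hull of a recurrent function. An orbit point
  \<open>shift a g\<close> close to h returns near g within a further time of at most l, and h
  follows it during that time; l and \<delta> are fixed before a is known.\<close>

lemma recurrent_in_flow_hull:
  fixes g :: "'a::metric_space cfun"
  assumes rec: "recurrent g" and h: "h \<in> flow_hull g"
  shows "g \<in> flow_hull h"
  unfolding flow_hull_def closure_approachable
proof (intro allI impI)
  fix \<epsilon> :: real
  assume "0 < \<epsilon>"
  then obtain l where "l > 0"
    and l: "\<And>a. infdist g ((\<lambda>t. shift t g) ` {a..a + l}) < \<epsilon> / 2"
    using rec unfolding recurrent_def by (metis half_gt_zero)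
  obtain \<delta> where "\<delta> > 0" and \<delta>: "\<And>(g :: 'a cfun) h s. dist g h < \<delta> \<Longrightarrow> \<bar>s\<bar> \<le> l \<Longrightarrow>
      dist (shift s g) (shift s h) < \<epsilon> / 2"
    using shift_equicontinuous[of "\<epsilon> / 2" l] \<open>0 < \<epsilon>\<close> by (metis half_gt_zero)
  obtain a where a: "dist (shift a g) h < \<delta>"
    using h \<open>\<delta> > 0\<close> unfolding flow_hull_def closure_approachable by blast
  \<comment> \<open>\<open>infdist\<close> to the empty set is 0 by convention. For a nonempty set
    it is an infimum, and a strict bound on it is attained by some point of the set.\<close>
  have "(\<lambda>t. shift t g) ` {a..a + l} \<noteq> {}"
    using \<open>l > 0\<close> by simp
  from l[of a, unfolded infdist_notempty[OF this]]
  have "(INF h\<in>(\<lambda>t. shift t g) ` {a..a + l}. dist g h) < \<epsilon> / 2"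
    .
  from cInf_lessD[OF _ this] \<open>l > 0\<close>
  obtain t where t: "t \<in> {a..a + l}" "dist g (shift t g) < \<epsilon> / 2"
    by auto
  have "dist (shift (t - a) (shift a g)) (shift (t - a) h) < \<epsilon> / 2"
    using t(1) by (intro \<delta> a) auto
  then have "dist (shift t g) (shift (t - a) h) < \<epsilon> / 2"
    by (simp add: shift_shift)
  with t(2) have "dist (shift (t - a) h) g < \<epsilon>"
    by (metis dist_commute dist_triangle_half_r)
  then show "\<exists>y\<in>range (\<lambda>t. shift t h). dist y g < \<epsilon>"
    by blast
qed

section \<open>Minimal sets\<close>

lemma compact_minimal_set_exists:
  fixes T :: "real \<Rightarrow> 'b::metric_space \<Rightarrow> 'b"
  assumes "compact S" "S \<noteq> {}" and inv: "\<And>t x. x \<in> S \<Longrightarrow> T t x \<in> S"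
    and cont: "\<And>t. continuous_on UNIV (T t)"
    and add: "\<And>s t x. T s (T t x) = T (s + t) x"
    and zero: "\<And>x. T 0 x = x"
  shows "\<exists>M\<subseteq>S. compact M \<and> M \<noteq> {} \<and> (\<forall>x\<in>M. \<forall>t. T t x \<in> M) \<and>
    (\<forall>x\<in>M. M \<subseteq> closure (range (\<lambda>t. T t x)))"
proof -
  text \<open>A minimal set is the trace on \<open>S\<close> of the complement of a maximal invariant open set not
    covering \<open>S\<close>.\<close>
  define \<A> where "\<A> = {U. open U \<and> (\<forall>t. \<forall>x\<in>U. T t x \<in> U) \<and> \<not> S \<subseteq> U}"
  have "\<exists>U\<in>\<A>. \<forall>X\<in>\<A>. U \<subseteq> X \<longrightarrow> X = U"
  proof (rule subset_Zorn_nonempty)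
    show "\<A> \<noteq> {}"
      using \<open>S \<noteq> {}\<close> by (auto simp: \<A>_def intro!: exI[of _ "{}"])
    fix \<C> assume "\<C> \<noteq> {}" and chain: "subset.chain \<A> \<C>"
    then have \<C>: "\<C> \<subseteq> \<A>"
      by (simp add: subset_chain_def)
    \<comment> \<open>Compactness keeps the union admissible: a finite subcover taken from a chain
      lies inside a single member, which would then cover S.\<close>
    have "\<not> S \<subseteq> \<Union>\<C>"
    proof
      assume "S \<subseteq> \<Union>\<C>"
      then obtain \<F> where \<F>: "\<F> \<subseteq> \<C>" "finite \<F>" "S \<subseteq> \<Union>\<F>"
        using \<C> compactE[OF \<open>compact S\<close>, of \<C>] by (force simp: \<A>_def)
      obtain U where "U \<in> \<C>" "\<Union>\<F> \<subseteq> U"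
      proof (cases "\<F> = {}")
        case True
        with \<open>\<C> \<noteq> {}\<close> that show ?thesis
          by blast
      next
        case False
        have "subset.chain \<A> \<F>"
          using chain \<F>(1) unfolding subset_chain_def by (meson subset_iff)
        with \<F>(2) False have "\<Union>\<F> \<in> \<F>"
          by (rule Union_in_chain)
        with \<F>(1) that[of "\<Union>\<F>"] show ?thesis
          by (meson order_refl subset_iff)
      qed
      then have "S \<subseteq> U" "U \<in> \<A>"
        using \<F>(3) \<C> by (meson order_trans subset_iff)+
      then show False
        by (simp add: \<A>_def)
    qed
    moreover have "open (\<Union>\<C>)"
      using \<C> by (intro open_Union) (auto simp: \<A>_def)
    moreover have "T t x \<in> \<Union>\<C>" if x: "x \<in> \<Union>\<C>" for t x
    proof -
      obtain U where "U \<in> \<C>" "x \<in> U"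
        using x by (rule UnionE)
      then have "T t x \<in> U"
        using \<C> unfolding \<A>_def by blast
      with \<open>U \<in> \<C>\<close> show ?thesis
        by (rule UnionI)
    qed
    ultimately show "\<Union>\<C> \<in> \<A>"
      unfolding \<A>_def by (intro CollectI conjI allI ballI)
  qed
  then obtain U where U: "U \<in> \<A>" and max: "\<And>V. V \<in> \<A> \<Longrightarrow> U \<subseteq> V \<Longrightarrow> V = U"
    by blast
  \<comment> \<open>Negative times are allowed, so the complement of an invariant set is
    invariant.\<close>
  have U_inv: "x \<in> U" if "T t x \<in> U" for t x
  proof -
    have "T (- t) (T t x) \<in> U"
      using U that by (simp add: \<A>_def)
    then show ?thesis
      by (simp add: add zero)
  qed
  show ?thesis
  proof (intro exI[of _ "S - U"] conjI ballI allI)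
    show "compact (S - U)"
      using U \<open>compact S\<close> by (auto simp: \<A>_def intro: compact_diff)
    show "S - U \<noteq> {}"
      using U by (auto simp: \<A>_def)
    show "T t x \<in> S - U" if "x \<in> S - U" for x t
      using that inv U_inv by blast
    fix x assume x: "x \<in> S - U"
    \<comment> \<open>The complement of an orbit closure is open and invariant. Joined to U it still
      misses x, so maximality forces it into U, which puts \<open>S - U\<close> inside the orbit
      closure.\<close>
    define C where "C = closure (range (\<lambda>t. T t x))"
    have "T t y \<in> C" if "y \<in> C" for t y
    proof -
      have "T t ` C \<subseteq> closure (T t ` range (\<lambda>t. T t x))"
        unfolding C_def by (rule image_closure_subset[OF continuous_on_subset[OF cont]])
          (auto intro: closure_subset[THEN subsetD])
      also have "T t ` range (\<lambda>t. T t x) \<subseteq> range (\<lambda>t. T t x)"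
        by (auto simp: add)
      finally show ?thesis
        using that unfolding C_def by (meson closure_mono image_subset_iff subset_iff)
    qed
    then have "T t y \<in> - C" if "y \<in> - C" for t y
      using that by (metis ComplD ComplI add ab_left_minus zero)
    moreover have "x \<in> C"
      unfolding C_def by (rule subsetD[OF closure_subset]) (metis rangeI zero)
    ultimately have "U \<union> - C \<in> \<A>"
      using U x by (auto simp: \<A>_def C_def)
    from max[OF this] show "S - U \<subseteq> closure (range (\<lambda>t. T t x))"
      unfolding C_def by blast
  qed blast
qed

text \<open>By minimality every orbit in M visits the ball around x, so the preimages of the ball
  cover M. By compactness finitely many times suffice, and these are bounded.\<close>

lemma minimal_set_relatively_dense:
  fixes T :: "real \<Rightarrow> 'b::metric_space \<Rightarrow> 'b"
  assumes "compact M" and inv: "\<And>t x. x \<in> M \<Longrightarrow> T t x \<in> M"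
    and minimal: "\<And>x. x \<in> M \<Longrightarrow> M \<subseteq> closure (range (\<lambda>t. T t x))"
    and cont: "\<And>t. continuous_on UNIV (T t)"
    and add: "\<And>s t x. T s (T t x) = T (s + t) x"
    and "x \<in> M" "0 < \<epsilon>"
  shows "\<exists>l>0. \<forall>a. \<exists>t\<in>{a..a + l}. dist x (T t x) < \<epsilon>"
proof -
  have opn: "open (T t -` ball x \<epsilon>)" for t
    using cont by (simp add: continuous_on_open_vimage)
  have cover: "M \<subseteq> (\<Union>t\<in>UNIV. T t -` ball x \<epsilon>)"
  proof
    fix y assume "y \<in> M"
    with minimal \<open>x \<in> M\<close> have "x \<in> closure (range (\<lambda>t. T t y))"
      by blast
    with \<open>0 < \<epsilon>\<close> show "y \<in> (\<Union>t\<in>UNIV. T t -` ball x \<epsilon>)"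
      by (auto simp: closure_approachable dist_commute)
  qed
  obtain C where C: "finite C" "M \<subseteq> (\<Union>t\<in>C. T t -` ball x \<epsilon>)"
    by (rule compactE_image[OF \<open>compact M\<close> opn cover])
  obtain b where b: "b > 0" "\<forall>t\<in>C. \<bar>t\<bar> \<le> b"
    using finite_imp_bounded[OF C(1)] by (auto simp: bounded_pos)
  \<comment> \<open>From the orbit point at time a + b the ball is reached after a lapse in [-b, b],
    hence at a time in [a, a + 2 * b].\<close>
  show ?thesis
  proof (intro exI[of _ "2 * b"] conjI allI)
    show "0 < 2 * b"
      using b by simp
    fix a
    obtain t where t: "t \<in> C" "T t (T (a + b) x) \<in> ball x \<epsilon>"
      using C(2) inv[OF \<open>x \<in> M\<close>] by blast
    then have "dist x (T (t + (a + b)) x) < \<epsilon>"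
      by (simp add: add)
    moreover have "t + (a + b) \<in> {a..a + 2 * b}"
      using b(2) t(1) by fastforce
    ultimately show "\<exists>t\<in>{a..a + 2 * b}. dist x (T t x) < \<epsilon>"
      by blast
  qed
qed

section \<open>Entire trajectories of the skew product flow\<close>

text \<open>An entire trajectory is encoded by two functions on the line, since its first component
  can only move by shifts. Such pairs carry a genuine flow, \<open>shift_pair\<close>, although
  \<Phi> is only a semiflow; this makes the results on minimal sets applicable.\<close>

definition state :: "'a::metric_space cfun \<times> 'a cfun \<Rightarrow> real \<Rightarrow> 'a cfun \<times> 'a"
  where "state w t = (shift t (fst w), apply_cfun (snd w) t)"

definition trajectories ::
    "(real \<Rightarrow> 'a cfun \<Rightarrow> 'a \<Rightarrow> 'a) \<Rightarrow> ('a::metric_space cfun \<times> 'a) set \<Rightarrow> ('a cfun \<times> 'a cfun) set"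
  where "trajectories \<phi> K =
    {w. \<forall>t. state w t \<in> K \<and> (\<forall>s\<le>t. state w t = skew_product \<phi> (t - s) (state w s))}"

abbreviation shift_pair :: "real \<Rightarrow> 'a::metric_space cfun \<times> 'a cfun \<Rightarrow> 'a cfun \<times> 'a cfun"
  where "shift_pair s \<equiv> map_prod (shift s) (shift s)"

lemma state_shift_pair: "state (shift_pair s w) t = state w (t + s)"
  by (simp add: state_def shift_shift)

lemma shift_pair_in_trajectories:
  assumes "w \<in> trajectories \<phi> K"
  shows "shift_pair s w \<in> trajectories \<phi> K"
  using assms by (auto simp: trajectories_def state_shift_pair) (smt (verit, best))

lemma continuous_on_shift_pair: "continuous_on A (shift_pair s)"
  unfolding map_prod_def case_prod_unfold
  by (intro continuous_on_Pair continuous_on_compose2[OF continuous_on_shift[of UNIV]]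
      continuous_intros) auto

section \<open>The semiflow on a compact invariant set and its space of trajectories\<close>

locale compact_invariant =
  fixes g :: "'a::metric_space cfun" and \<phi> :: "real \<Rightarrow> 'a cfun \<Rightarrow> 'a \<Rightarrow> 'a"
    and K :: "('a cfun \<times> 'a) set"
  assumes cocycle: "continuous_cocycle g \<phi>"
    and sub: "K \<subseteq> flow_hull g \<times> UNIV"
    and compact_K: "compact K"
    and invariant: "invariant_set \<phi> K"
begin

lemma skew_in: "0 \<le> t \<Longrightarrow> z \<in> K \<Longrightarrow> skew_product \<phi> t z \<in> K"
  using invariant unfolding invariant_set_def by blast

lemma skew_zero: "z \<in> K \<Longrightarrow> skew_product \<phi> 0 z = z"
  using cocycle sub by (cases z) (auto simp: continuous_cocycle_def skew_product_def)

lemma skew_add: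
  "0 \<le> s \<Longrightarrow> 0 \<le> t \<Longrightarrow> z \<in> K \<Longrightarrow>
    skew_product \<phi> (s + t) z = skew_product \<phi> s (skew_product \<phi> t z)"
  using cocycle sub by (cases z) (auto simp: continuous_cocycle_def skew_product_def shift_shift)

text \<open>Joint continuity in time and state is used for the second component only: it makes
  \<gamma> continuous and gives uniform continuity on compact time intervals. For the shift
  component, continuity at each fixed time is enough.\<close>

lemma continuous_on_snd_skew:
  "continuous_on ({0..} \<times> K) (\<lambda>(t, z). snd (skew_product \<phi> t z))"
proof -
  have "continuous_on ({0..} \<times> flow_hull g \<times> UNIV) (\<lambda>(t, h, x). \<phi> t h x)"
    using cocycle by (simp add: continuous_cocycle_def)
  then have "continuous_on ({0..} \<times> K) (\<lambda>(t, h, x). \<phi> t h x)"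
    by (rule continuous_on_subset) (use sub in auto)
  then show ?thesis
    by (simp add: skew_product_def case_prod_unfold)
qed

lemma continuous_on_skew:
  assumes "0 \<le> t"
  shows "continuous_on K (skew_product \<phi> t)"
proof -
  have "continuous_on K (\<lambda>z. shift t (fst z))"
    by (rule continuous_on_compose2[OF continuous_on_shift[of UNIV]]) (auto intro: continuous_intros)
  moreover have "continuous_on K (\<lambda>z. (\<lambda>(t, z). snd (skew_product \<phi> t z)) (t, z))"
    by (rule continuous_on_compose2[OF continuous_on_snd_skew])
      (use assms in \<open>auto intro!: continuous_intros\<close>)
  ultimately have "continuous_on K (\<lambda>z. (shift t (fst z), snd (skew_product \<phi> t z)))"
    unfolding prod.case by (rule continuous_on_Pair)
  then show ?thesis
    by (rule continuous_on_eq) (simp add: skew_product_def case_prod_unfold)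
qed

text \<open>Start a forward orbit from \<open>z k\<close> at time -k. By \<open>step\<close> the
  orbit started one unit earlier passes through \<open>z k\<close>, so these pieces agree where both
  are defined and glue together.\<close>

lemma trajectory_through_backward_orbit:
  assumes z: "\<And>k. z k \<in> K" and step: "\<And>k. skew_product \<phi> 1 (z (Suc k)) = z k"
  shows "\<exists>w\<in>trajectories \<phi> K. \<forall>k. state w (- real k) = z k"
proof -
  define P where "P k t = skew_product \<phi> (t + real k) (z k)" for k t
  have P_Suc: "P (Suc k) t = P k t" if "- real k \<le> t" for k t
    using skew_add[of "t + real k" 1 "z (Suc k)"] that z step by (simp add: P_def add_ac)
  have P_add: "P (k + m) t = P k t" if "- real k \<le> t" for k m t
    using that by (induction m) (simp_all add: P_Suc)
  \<comment> \<open>The index is the least natural k with -k \<le> t; every larger index gives the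
    same value.\<close>
  define W where "W t = P (nat \<lceil>- t\<rceil>) t" for t
  have W: "W t = P k t" if "- real k \<le> t" for k t
  proof -
    have "nat \<lceil>- t\<rceil> \<le> k" and "- real (nat \<lceil>- t\<rceil>) \<le> t"
      using that by linarith+
    then show ?thesis
      unfolding W_def using P_add[of "nat \<lceil>- t\<rceil>" t "k - nat \<lceil>- t\<rceil>"] by simp
  qed
  have bound: "\<exists>k. - real k < t" for t
    using reals_Archimedean2[of "- t"] by (metis minus_less_iff)
  \<comment> \<open>Near t only one piece is involved: the strict bound on k makes t an interior
    point of its half-line.\<close>
  have "continuous_on UNIV (\<lambda>t. snd (W t))"
  proof (rule continuous_at_imp_continuous_on, rule ballI)
    fix t
    obtain k where k: "- real k < t"
      using bound by blast
    have "continuous_on {- real k<..} (\<lambda>t. (\<lambda>(t, z). snd (skew_product \<phi> t z)) (t + real k, z k))"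
      by (rule continuous_on_compose2[OF continuous_on_snd_skew])
        (use z in \<open>auto intro!: continuous_intros\<close>)
    then have "continuous_on {- real k<..} (\<lambda>t. snd (W t))"
      by (rule continuous_on_eq) (simp add: W[of k] P_def)
    with k show "isCont (\<lambda>t. snd (W t)) t"
      by (simp add: continuous_on_eq_continuous_at)
  qed
  then have app: "apply_cfun (Cfun (\<lambda>t. snd (W t))) = (\<lambda>t. snd (W t))"
    by (simp add: Cfun_inverse)
  \<comment> \<open>The first entry is the forcing term of the state at time 0; \<open>fst_z\<close>
    shows that it agrees with all earlier states.\<close>
  define w where "w = (fst (z 0), Cfun (\<lambda>t. snd (W t)))"
  have fst_P: "fst (P k t) = shift (t + real k) (fst (z k))" for k t
    by (simp add: P_def skew_product_def case_prod_unfold)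
  have fst_z: "shift (real k) (fst (z k)) = fst (z 0)" for k
    using fst_P[of k 0] P_add[of 0 0 k] skew_zero[OF z[of 0]] by (simp add: P_def)
  have state_w: "state w t = W t" for t
  proof -
    obtain k where k: "- real k < t"
      using bound by blast
    have "fst (W t) = shift t (shift (real k) (fst (z k)))"
      using k by (simp add: W[of k] fst_P shift_shift)
    then show ?thesis
      by (simp add: state_def w_def app fst_z prod_eq_iff)
  qed
  have "W t \<in> K" for t
  proof -
    obtain k where k: "- real k < t"
      using bound by blast
    then show ?thesis
      by (simp add: W[of k] P_def skew_in z)
  qed
  moreover have "W t = skew_product \<phi> (t - s) (W s)" if "s \<le> t" for s t
  proof -
    obtain k where k: "- real k < s"
      using bound by blast
    with that show ?thesis
      using skew_add[of "t - s" "s + real k" "z k"] z by (simp add: W[of k] P_def)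
  qed
  ultimately have "w \<in> trajectories \<phi> K"
    by (simp add: trajectories_def state_w)
  moreover have "state w (- real k) = z k" for k
    by (simp add: state_w W[of k] P_def skew_zero z)
  ultimately show ?thesis
    by blast
qed

lemma trajectories_nonempty:
  assumes "K \<noteq> {}"
  shows "trajectories \<phi> K \<noteq> {}"
proof -
  have "skew_product \<phi> 1 ` K = K"
    using invariant by (simp add: invariant_set_def)
  then have "\<exists>y. y \<in> K \<and> skew_product \<phi> 1 y = x" if "x \<in> K" for x
    using that by (metis imageE)
  moreover have "\<exists>x. x \<in> K"
    using assms by blast
  ultimately obtain z where "\<And>k. z k \<in> K" "\<And>k. skew_product \<phi> 1 (z (Suc k)) = z k"
    using dependent_nat_choice[of "\<lambda>_ x. x \<in> K" "\<lambda>_ x y. skew_product \<phi> 1 y = x"] by metis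
  then show ?thesis
    using trajectory_through_backward_orbit by blast
qed

text \<open>Sampling at the times -k turns trajectories into points of a countable power of K. A
  limit of samples is again a backward orbit, and the trajectory through it is the desired
  limit.\<close>

lemma compact_trajectories: "compact (trajectories \<phi> K)"
  unfolding compact_def
proof (intro allI impI)
  fix \<sigma> :: "nat \<Rightarrow> 'a cfun \<times> 'a cfun"
  assume "\<forall>n. \<sigma> n \<in> trajectories \<phi> K"
  then have \<sigma>: "state (\<sigma> n) t \<in> K"
    "s \<le> t \<Longrightarrow> state (\<sigma> n) t = skew_product \<phi> (t - s) (state (\<sigma> n) s)" for n s t
    unfolding trajectories_def by blast+
  define Z where "Z n k = state (\<sigma> n) (- real k)" for n k
  \<comment> \<open>This is Tychonoff's theorem; the countable power is metrizable, so it is also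
    sequentially compact.\<close>
  have "compact (PiE UNIV (\<lambda>_ :: nat. K))"
    using compactin_PiE[of "\<lambda>_. euclidean" "UNIV :: nat set" "\<lambda>_. K"] compact_K
    by (simp add: euclidean_product_topology)
  moreover have "Z n \<in> PiE UNIV (\<lambda>_. K)" for n
    by (auto simp: Z_def \<sigma>)
  ultimately obtain z r where "z \<in> PiE UNIV (\<lambda>_. K)" and r: "strict_mono r"
    and "(Z \<circ> r) \<longlonglongrightarrow> z"
    unfolding compact_def by meson
  then have z: "z k \<in> K" and lim: "(\<lambda>n. Z (r n) k) \<longlonglongrightarrow> z k" for k
    using continuous_on_tendsto_compose[OF continuous_on_product_coordinates[of k]]
    by (auto simp: o_def)
  \<comment> \<open>The backward orbit relation is closed, by continuity of \<Phi>(1) on K.\<close>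
  have "skew_product \<phi> 1 (z (Suc k)) = z k" for k
  proof (rule LIMSEQ_unique[OF _ lim])
    have "(\<lambda>n. skew_product \<phi> 1 (Z (r n) (Suc k))) \<longlonglongrightarrow> skew_product \<phi> 1 (z (Suc k))"
      by (rule continuous_on_tendsto_compose[OF continuous_on_skew lim z])
        (auto simp: Z_def \<sigma>)
    moreover have "skew_product \<phi> 1 (Z n (Suc k)) = Z n k" for n
      using \<sigma>(2)[of "- real (Suc k)" "- real k" n] by (simp add: Z_def)
    ultimately show "(\<lambda>n. Z (r n) k) \<longlonglongrightarrow> skew_product \<phi> 1 (z (Suc k))"
      by simp
  qed
  then obtain w where w: "w \<in> trajectories \<phi> K" and wz: "\<And>k. state w (- real k) = z k"
    using trajectory_through_backward_orbit[of z] z by blast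
  have "(\<lambda>n. fst (\<sigma> (r n))) \<longlonglongrightarrow> fst w"
    using tendsto_fst[OF lim[of 0]] by (simp add: Z_def wz[symmetric] state_def)
  moreover have "(\<lambda>n. snd (\<sigma> (r n))) \<longlonglongrightarrow> snd w"
  proof (rule tendsto_cfunI, rule uniform_limitI)
    fix k and \<epsilon> :: real
    assume "0 < \<epsilon>"
    \<comment> \<open>A time t in [-k, k] lies t + k, hence at most 2k, after the sampled state at
      -k.\<close>
    have "uniformly_continuous_on ({0..2 * real k} \<times> K) (\<lambda>(t, z). snd (skew_product \<phi> t z))"
      by (intro compact_uniformly_continuous compact_Times compact_Icc compact_K
          continuous_on_subset[OF continuous_on_snd_skew]) auto
    then obtain \<delta> where "\<delta> > 0" and \<delta>: "\<And>t x y. t \<in> {0..2 * real k} \<Longrightarrow> x \<in> K \<Longrightarrow> y \<in> K \<Longrightarrow>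
        dist x y < \<delta> \<Longrightarrow> dist (snd (skew_product \<phi> t x)) (snd (skew_product \<phi> t y)) < \<epsilon>"
      unfolding uniformly_continuous_on_def using \<open>0 < \<epsilon>\<close>
      by (force simp: dist_Pair_Pair)
    have eq: "apply_cfun (snd v) t = snd (skew_product \<phi> (t + real k) (state v (- real k)))"
      if "v \<in> trajectories \<phi> K" "- real k \<le> t" for v t
    proof -
      have "state v t = skew_product \<phi> (t - - real k) (state v (- real k))"
        using that unfolding trajectories_def by blast
      then show ?thesis
        by (metis diff_minus_eq_add snd_conv state_def)
    qed
    from tendstoD[OF lim[of k] \<open>\<delta> > 0\<close>]
    show "\<forall>\<^sub>F n in sequentially. \<forall>t\<in>{- real k..real k}.
        dist (apply_cfun (snd (\<sigma> (r n))) t) (apply_cfun (snd w) t) < \<epsilon>"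
    proof eventually_elim
      case (elim n)
      show ?case
      proof
        fix t assume t: "t \<in> {- real k..real k}"
        have "dist (snd (skew_product \<phi> (t + real k) (Z (r n) k)))
            (snd (skew_product \<phi> (t + real k) (z k))) < \<epsilon>"
          by (rule \<delta>) (use t elim z \<sigma> in \<open>auto simp: Z_def\<close>)
        then show "dist (apply_cfun (snd (\<sigma> (r n))) t) (apply_cfun (snd w) t) < \<epsilon>"
          using t w \<open>\<forall>n. \<sigma> n \<in> trajectories \<phi> K\<close> by (simp add: eq wz Z_def)
      qed
    qed
  qed
  ultimately have "(\<lambda>n. (fst (\<sigma> (r n)), snd (\<sigma> (r n)))) \<longlonglongrightarrow> (fst w, snd w)"
    by (rule tendsto_Pair)
  then show "\<exists>l\<in>trajectories \<phi> K. \<exists>r. strict_mono r \<and> (\<sigma> \<circ> r) \<longlonglongrightarrow> l"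
    using w r by (auto simp: o_def)
qed

lemma entire_solution_trajectory:
  assumes "(g, \<gamma>) \<in> trajectories \<phi> K"
  shows "entire_solution g \<phi> (apply_cfun \<gamma>)"
  unfolding entire_solution_def solution_operator_def
proof (intro allI impI)
  fix s t :: real
  assume "s \<le> t"
  with assms have "state (g, \<gamma>) t = skew_product \<phi> (t - s) (state (g, \<gamma>) s)"
    unfolding trajectories_def by blast
  then show "apply_cfun \<gamma> t = \<phi> (t - s) (shift s g) (apply_cfun \<gamma> s)"
    by (simp add: state_def skew_product_def)
qed

end

section \<open>Extraction of a recurrent solution from a minimal set of trajectories\<close>

theorem theorem3p3:
  fixes D :: "'a::banach set"
    and f :: "'a \<Rightarrow> 'a"
    and g :: "'a cfun"
    and \<phi> :: "real \<Rightarrow> 'a cfun \<Rightarrow> 'a \<Rightarrow> 'a"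
    and K :: "('a cfun \<times> 'a) set"
  assumes "continuous_on D f"
    and "solution_cocycle D f g \<phi>"
    and "recurrent g"
    and "K \<subseteq> flow_hull g \<times> UNIV"
    and "K \<noteq> {}"
    and "compact K"
    and "invariant_set \<phi> K"
  shows "\<exists>\<gamma> :: 'a cfun. recurrent \<gamma> \<and> entire_solution g \<phi> (apply_cfun \<gamma>) \<and>
    {(shift t g, apply_cfun \<gamma> t) | t. t \<in> UNIV} \<subseteq> K"
proof -
  interpret compact_invariant g \<phi> K
    using assms by unfold_locales (simp_all add: solution_cocycle_def)
  have add: "shift_pair s (shift_pair t w) = shift_pair (s + t) w"
    for s t and w :: "'a cfun \<times> 'a cfun"
    by (cases w) (simp add: shift_shift)
  have zero: "shift_pair 0 w = w" for w :: "'a cfun \<times> 'a cfun"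
    by (cases w) simp
  have "\<exists>M\<subseteq>trajectories \<phi> K. compact M \<and> M \<noteq> {} \<and> (\<forall>w\<in>M. \<forall>t. shift_pair t w \<in> M) \<and>
    (\<forall>w\<in>M. M \<subseteq> closure (range (\<lambda>t. shift_pair t w)))"
    by (rule compact_minimal_set_exists[where T = shift_pair])
      (rule compact_trajectories trajectories_nonempty \<open>K \<noteq> {}\<close> shift_pair_in_trajectories
        continuous_on_shift_pair add zero | assumption)+
  then obtain M where M: "M \<subseteq> trajectories \<phi> K" "compact M" "M \<noteq> {}"
    and M_inv: "\<forall>w\<in>M. \<forall>t. shift_pair t w \<in> M"
    and M_min: "\<forall>w\<in>M. M \<subseteq> closure (range (\<lambda>t. shift_pair t w))"
    by (elim exE conjE)
  note inv = M_inv[THEN bspec, THEN spec] and minimal = M_min[THEN bspec]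
  have closed: "compact (fst ` M)" "compact (snd ` M)"
    using M(2) by (auto intro!: compact_continuous_image continuous_intros)
  obtain w where w: "w \<in> M"
    using M(3) by blast
  have "fst w \<in> flow_hull g"
  proof -
    have "state w 0 \<in> K"
      using w M(1) unfolding trajectories_def by blast
    then show ?thesis
      using sub by (auto simp: state_def)
  qed
  with \<open>recurrent g\<close> have "g \<in> flow_hull (fst w)"
    by (rule recurrent_in_flow_hull)
  \<comment> \<open>The projection of M is compact, hence closed, so with the orbit of
    \<open>fst w\<close> it contains the whole hull of \<open>fst w\<close>, and therefore
    g.\<close>
  moreover have "range (\<lambda>t. shift t (fst w)) \<subseteq> fst ` M"
    using inv[OF w] by (auto intro!: image_eqI[where x = "shift_pair _ w"])
  ultimately have "g \<in> fst ` M"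
    unfolding flow_hull_def using closure_minimal[OF _ compact_imp_closed[OF closed(1)]] by blast
  then obtain \<gamma> where \<gamma>: "(g, \<gamma>) \<in> M"
    by force
  have "recurrent \<gamma>"
    unfolding recurrent_def
  proof (intro conjI allI impI)
    \<comment> \<open>The hull of \<gamma> is a closed subset of the compact second projection of
      M.\<close>
    have "range (\<lambda>t. shift t \<gamma>) \<subseteq> snd ` M"
      using inv[OF \<gamma>] by (force intro!: image_eqI[where x = "shift_pair _ (g, \<gamma>)"])
    then have "flow_hull \<gamma> \<subseteq> snd ` M"
      unfolding flow_hull_def by (rule closure_minimal[OF _ compact_imp_closed[OF closed(2)]])
    then show "compact (flow_hull \<gamma>)"
      using closed(2) unfolding flow_hull_def
      by (metis closed_closure compact_Int_closed inf.absorb_iff2)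
    fix \<epsilon> :: real
    assume "0 < \<epsilon>"
    \<comment> \<open>Return times of the pair serve for \<gamma> alone, since the product metric
      dominates the distance of the second entries.\<close>
    then obtain l where "l > 0"
      and l: "\<And>a. \<exists>t\<in>{a..a + l}. dist (g, \<gamma>) (shift_pair t (g, \<gamma>)) < \<epsilon>"
      using minimal_set_relatively_dense[OF M(2), of shift_pair, OF inv minimal
        continuous_on_shift_pair add \<gamma>] by blast
    have "infdist \<gamma> ((\<lambda>t. shift t \<gamma>) ` {a..a + l}) < \<epsilon>" for a
    proof -
      obtain t where t: "t \<in> {a..a + l}" "dist (g, \<gamma>) (shift_pair t (g, \<gamma>)) < \<epsilon>"
        using l by blast
      have "infdist \<gamma> ((\<lambda>t. shift t \<gamma>) ` {a..a + l}) \<le> dist \<gamma> (shift t \<gamma>)"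
        using t(1) by (intro infdist_le) simp
      also have "\<dots> \<le> dist (g, \<gamma>) (shift_pair t (g, \<gamma>))"
        using dist_snd_le[of "(g, \<gamma>)" "shift_pair t (g, \<gamma>)"] by simp
      finally show ?thesis
        using t(2) by linarith
    qed
    with \<open>l > 0\<close> show "\<exists>l>0. \<forall>a. infdist \<gamma> ((\<lambda>t. shift t \<gamma>) ` {a..a + l}) < \<epsilon>"
      by blast
  qed
  moreover have "(g, \<gamma>) \<in> trajectories \<phi> K"
    using \<gamma> M(1) by blast
  moreover from this have "(shift t g, apply_cfun \<gamma> t) \<in> K" for t
    unfolding trajectories_def state_def by simp
  ultimately show ?thesis
    using entire_solution_trajectory by blast
qed

end
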